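(* Let $\mathcal{S}=\langle\mathcal{L},\vdash\rangle$ be a monotonic and transitive logic, with $\mathcal{L}$ a formula algebra over a denumerable set of variables $V$, such that $\emptyset\not\vdash q$ for all $q\in V$. If there is no falsity constant for $\mathcal{S}$ in $\mathcal{L}$, then $\mathcal{S}^{l}$ is NF-paraconsistent.
   Context: A logic is a pair $\langle\mathcal{L},\vdash\rangle$ with $\vdash\,\subseteq\mathcal{P}(\mathcal{L})\times\mathcal{L}$, and $C_\vdash(\Gamma)=\{\alpha:\Gamma\vdash\alpha\}$. Monotonic: $\Gamma\subseteq\Sigma$ implies $C_\vdash(\Gamma)\subseteq C_\vdash(\Sigma)$. Transitive: $\Sigma\subseteq C_\vdash(\Gamma)$ implies $C_\vdash(\Sigma)\subseteq C_\vdash(\Gamma)$. $\mathcal{L}$ is the formula algebra over a denumerable set $V$ of variables in a finite signature. $\mathrm{var}(\alpha)$ is the set of variables in $\alpha$; $\mathrm{var}(\Delta)=\bigcup_{\alpha\in\Delta}\mathrm{var}(\alpha)$. A falsity constant is a constant $\bot\in\mathcal{L}$ (with $\mathrm{var}(\bot)=\emptyset$) such that $\{\bot\}\vdash\alpha$ for all $\alpha\in\mathcal{L}$. $\mathcal{S}^l=\langle\mathcal{L},\vdash^l\rangle$ where $\Gamma\vdash^l\alpha$ iff there is $\Delta\subseteq\Gamma$ with $\mathrm{var}(\Delta)\subseteq\mathrm{var}(\alpha)$ and $\Delta\vdash\alpha$. A logic is NF-paraconsistent if there exists $\alpha\in\mathcal{L}$ such that $C_\vdash(\{\alpha,\beta\})\neq\mathcal{L}$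 for every $\beta\in\mathcal{L}$. *)

theory Defs
  imports Main "HOL-Library.Countable_Set"
begin

type_synonym 'a consequence = "('a set \<times> 'a) set"

definition is_logic :: "'a set \<Rightarrow> 'a consequence \<Rightarrow> bool" where
  "is_logic L R \<longleftrightarrow> R \<subseteq> Pow L \<times> L"

definition Cn :: "'a consequence \<Rightarrow> 'a set \<Rightarrow> 'a set" where
  "Cn R \<Gamma> = {\<alpha>. (\<Gamma>, \<alpha>) \<in> R}"

definition monotonic :: "'a set \<Rightarrow> 'a consequence \<Rightarrow> bool" where
  "monotonic L R \<longleftrightarrow> (\<forall>\<Gamma> \<Sigma>. \<Gamma> \<subseteq> L \<longrightarrow> \<Sigma> \<subseteq> L \<longrightarrow> \<Gamma> \<subseteq> \<Sigma> \<longrightarrow> Cn R \<Gamma> \<subseteq> Cn R \<Sigma>)"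

definition transitive :: "'a set \<Rightarrow> 'a consequence \<Rightarrow> bool" where
  "transitive L R \<longleftrightarrow> (\<forall>\<Gamma> \<Sigma>. \<Gamma> \<subseteq> L \<longrightarrow> \<Sigma> \<subseteq> L \<longrightarrow> \<Sigma> \<subseteq> Cn R \<Gamma> \<longrightarrow> Cn R \<Sigma> \<subseteq> Cn R \<Gamma>)"

definition NF_paraconsistent :: "'a set \<Rightarrow> 'a consequence \<Rightarrow> bool" where
  "NF_paraconsistent L R \<longleftrightarrow> (\<exists>\<alpha>\<in>L. \<forall>\<beta>\<in>L. Cn R {\<alpha>, \<beta>} \<noteq> L)"

datatype ('f, vars: 'v) fm = Var 'v | App 'f "('f, 'v) fm list"

text \<open>The carrier of the absolutely free algebra over \<open>V\<close> in the signature whose connectives are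
  the elements of \<open>F\<close>, with arities \<open>ar\<close>.\<close>

inductive_set formulas :: "'f set \<Rightarrow> ('f \<Rightarrow> nat) \<Rightarrow> 'v set \<Rightarrow> ('f, 'v) fm set"
  for F :: "'f set" and ar :: "'f \<Rightarrow> nat" and V :: "'v set" where
  Var: "v \<in> V \<Longrightarrow> Var v \<in> formulas F ar V"
| App: "f \<in> F \<Longrightarrow> length ts = ar f \<Longrightarrow> (\<And>t. t \<in> set ts \<Longrightarrow> t \<in> formulas F ar V) \<Longrightarrow>
    App f ts \<in> formulas F ar V"

definition vars_set :: "('f, 'v) fm set \<Rightarrow> 'v set" where
  "vars_set \<Delta> = (\<Union>\<alpha>\<in>\<Delta>. vars \<alpha>)"

text \<open>A constant is any variable-free formula, not necessarily a nullary connective.\<close>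

definition falsity_constant ::
  "('f, 'v) fm set \<Rightarrow> ('f, 'v) fm consequence \<Rightarrow> ('f, 'v) fm \<Rightarrow> bool" where
  "falsity_constant L R b \<longleftrightarrow> b \<in> L \<and> vars b = {} \<and> (\<forall>\<alpha>\<in>L. ({b}, \<alpha>) \<in> R)"

text \<open>The consequence relation of the logic \<open>S\<^sup>l\<close> associated with \<open>S = \<langle>L, R\<rangle>\<close>.\<close>

definition left_companion ::
  "('f, 'v) fm set \<Rightarrow> ('f, 'v) fm consequence \<Rightarrow> ('f, 'v) fm consequence" where
  "left_companion L R = {(\<Gamma>, \<alpha>). \<Gamma> \<subseteq> L \<and> \<alpha> \<in> L \<and>
     (\<exists>\<Delta>\<subseteq>\<Gamma>. vars_set \<Delta> \<subseteq> vars \<alpha> \<and> (\<Delta>, \<alpha>) \<in> R)}"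

end

theory Submission
  imports Defs
begin

text \<open>Suppose every formula explodes in \<open>S\<^sup>l\<close> together with some other formula. If \<open>\<beta>\<close> does so with a
  variable \<open>p\<close>, then deriving a variable foreign to \<open>\<beta>\<close> and \<open>p\<close> must use \<open>\<beta>\<close> alone, so \<open>\<beta>\<close> is
  variable-free and entails every formula not containing \<open>p\<close>. Substitution invariance is not
  available to reach \<open>p\<close> itself; instead take the partner \<open>\<beta>'\<close> of a second variable \<open>p'\<close>: then
  \<open>\<beta>\<close> entails \<open>\<beta>'\<close>, which entails \<open>p\<close>. Hence \<open>\<beta>\<close> entails both \<open>\<beta>\<close> and \<open>p\<close>, so by transitivity it
  is a falsity constant.\<close>

lemma finite_vars: "finite (vars \<phi>)"
  by (induction \<phi>) auto

text \<open>The last two claims split the work: formulas without \<open>p\<close> follow from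
  \<beta> alone, while the others need the pair, whose extra premise \<open>Var p\<close> is cut
  away later.\<close>

lemma left_companion_explosion_constant:
  assumes V: "infinite V"
    and mono: "monotonic (formulas F ar V) R"
    and no_thm: "\<forall>q\<in>V. ({}, Var q) \<notin> R"
    and p: "p \<in> V"
    and \<beta>: "\<beta> \<in> formulas F ar V"
    and expl: "Cn (left_companion (formulas F ar V) R) {Var p, \<beta>} = formulas F ar V"
  shows "vars \<beta> = {}"
    and "\<And>\<alpha>. \<alpha> \<in> formulas F ar V \<Longrightarrow> ({Var p, \<beta>}, \<alpha>) \<in> R"
    and "\<And>\<alpha>. \<alpha> \<in> formulas F ar V \<Longrightarrow> p \<notin> vars \<alpha> \<Longrightarrow> ({\<beta>}, \<alpha>) \<in> R"
proof -
  have Vp: "Var p \<in> formulas F ar V"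
    using p by (rule formulas.Var)
  have derives: "\<exists>\<Delta>\<subseteq>{Var p, \<beta>}. vars_set \<Delta> \<subseteq> vars \<alpha> \<and> (\<Delta>, \<alpha>) \<in> R"
    if "\<alpha> \<in> formulas F ar V" for \<alpha>
  proof -
    have "\<alpha> \<in> Cn (left_companion (formulas F ar V) R) {Var p, \<beta>}"
      using that expl by blast
    then show ?thesis
      by (simp add: Cn_def left_companion_def)
  qed
  have weaken: "(\<Sigma>, \<alpha>) \<in> R" if "(\<Delta>, \<alpha>) \<in> R" "\<Delta> \<subseteq> \<Sigma>" "\<Sigma> \<subseteq> formulas F ar V" for \<Delta> \<Sigma> \<alpha>
    using mono that unfolding monotonic_def Cn_def by blast
  show "({Var p, \<beta>}, \<alpha>) \<in> R" if "\<alpha> \<in> formulas F ar V" for \<alpha>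
    using derives[OF that] weaken Vp \<beta> by blast
  show "({\<beta>}, \<alpha>) \<in> R" if \<alpha>: "\<alpha> \<in> formulas F ar V" and "p \<notin> vars \<alpha>" for \<alpha>
  proof -
    obtain \<Delta> where \<Delta>: "\<Delta> \<subseteq> {Var p, \<beta>}" "vars_set \<Delta> \<subseteq> vars \<alpha>" "(\<Delta>, \<alpha>) \<in> R"
      using derives[OF \<alpha>] by blast
    then have "Var p \<notin> \<Delta>"
      using that(2) by (force simp: vars_set_def)
    \<comment> \<open>Only \<beta> can remain in \<Delta>, which may even be empty; monotonicity
      covers both cases.\<close>
    then show ?thesis
      using \<Delta> weaken \<beta> by blast
  qed
  have "infinite (V - insert p (vars \<beta>))"
    using V finite_vars by (simp add: Diff_infinite_finite)
  then obtain q where q: "q \<in> V" "q \<noteq> p" "q \<notin> vars \<beta>"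
    by (metis Diff_iff infinite_imp_nonempty insert_iff ex_in_conv)
  obtain \<Delta> where \<Delta>: "\<Delta> \<subseteq> {Var p, \<beta>}" "vars_set \<Delta> \<subseteq> {q}" "(\<Delta>, Var q) \<in> R"
    using derives[OF formulas.Var[OF q(1)]] by auto
  have "Var p \<notin> \<Delta>"
    using \<Delta>(2) q(2) by (force simp: vars_set_def)
  moreover have "\<Delta> \<noteq> {}"
    using \<Delta>(3) no_thm q(1) by blast
  ultimately have "\<beta> \<in> \<Delta>"
    using \<Delta>(1) by blast
  \<comment> \<open>As a member of \<Delta>, \<beta> has no variable except possibly
    \<open>q\<close>, which was chosen outside it.\<close>
  then show "vars \<beta> = {}"
    using \<Delta>(2) q(3) by (auto simp: vars_set_def)
qed

theorem theorem2p21: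
  fixes F :: "'f set" and ar :: "'f \<Rightarrow> nat" and V :: "'v set"
    and R :: "('f, 'v) fm consequence"
  assumes "finite F"
    and "countable V" and "infinite V"
    and "is_logic (formulas F ar V) R"
    and "monotonic (formulas F ar V) R"
    and "transitive (formulas F ar V) R"
    and "\<And>q. q \<in> V \<Longrightarrow> ({}, Var q) \<notin> R"
    and "\<not> (\<exists>b. falsity_constant (formulas F ar V) R b)"
  shows "NF_paraconsistent (formulas F ar V) (left_companion (formulas F ar V) R)"
proof (rule ccontr)
  let ?L = "formulas F ar V"
  assume "\<not> NF_paraconsistent ?L (left_companion ?L R)"
  then have partner: "\<exists>\<beta>\<in>?L. Cn (left_companion ?L R) {Var p, \<beta>} = ?L" if "p \<in> V" for p
    using formulas.Var[OF that] unfolding NF_paraconsistent_def by blast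
  obtain p where p: "p \<in> V"
    using assms(3) infinite_imp_nonempty by blast
  obtain p' where p': "p' \<in> V" "p' \<noteq> p"
    using assms(3) by (metis finite.emptyI finite_insert finite_subset singletonI subsetI singleton_iff)
  obtain \<beta> where \<beta>: "\<beta> \<in> ?L" "Cn (left_companion ?L R) {Var p, \<beta>} = ?L"
    using partner[OF p] by blast
  obtain \<beta>' where \<beta>': "\<beta>' \<in> ?L" "Cn (left_companion ?L R) {Var p', \<beta>'} = ?L"
    using partner[OF p'(1)] by blast
  have no_thm: "\<forall>q\<in>V. ({}, Var q) \<notin> R"
    using assms(7) by blast
  note c = left_companion_explosion_constant[OF assms(3,5) no_thm p \<beta>]
  note c' = left_companion_explosion_constant[OF assms(3,5) no_thm p'(1) \<beta>']
  have trans: "(\<Gamma>, \<alpha>) \<in> R"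
    if "(\<Sigma>, \<alpha>) \<in> R" "\<And>\<sigma>. \<sigma> \<in> \<Sigma> \<Longrightarrow> (\<Gamma>, \<sigma>) \<in> R" "\<Sigma> \<subseteq> ?L" "\<Gamma> \<subseteq> ?L" for \<Gamma> \<Sigma> \<alpha>
    using assms(6) that unfolding transitive_def Cn_def by blast
  have Vp: "Var p \<in> ?L"
    using p by (rule formulas.Var)
  \<comment> \<open>Being variable-free, \<beta>' does not contain \<open>p\<close>.\<close>
  have "({\<beta>}, \<beta>') \<in> R"
    using c(3)[OF \<beta>'(1)] c'(1) by simp
  moreover have "({\<beta>'}, Var p) \<in> R"
    using c'(3)[OF Vp] p'(2) by simp
  ultimately have "({\<beta>}, Var p) \<in> R"
    using trans[of "{\<beta>'}"] \<beta>(1) \<beta>'(1) by blast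
  \<comment> \<open>Reflexivity is not assumed; \<beta> entails itself because it does not contain
    \<open>p\<close>.\<close>
  moreover have "({\<beta>}, \<beta>) \<in> R"
    using c(3)[OF \<beta>(1)] c(1) by simp
  ultimately have "({\<beta>}, \<alpha>) \<in> R" if "\<alpha> \<in> ?L" for \<alpha>
    using trans[OF c(2)[OF that]] Vp \<beta>(1) by blast
  then have "falsity_constant ?L R \<beta>"
    using \<beta>(1) c(1) by (simp add: falsity_constant_def)
  then show False
    using assms(8) by blast
qed

end
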